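(* Let $G$ be a countable sofic group with a sofic approximation sequence $\Sigma$. Let $Z$ be a path-connected compact metrizable space, and consider the left shift action of $G$ on $X=Z^G$, given by $(sx)_t=x_{s^{-1}t}$ for $x\in Z^G$ and $s,t\in G$. Then for any nontrivial factor $Y$ of $X$ one has $$\mathrm{mdim}_\Sigma(Y)>0.$$
   Context: Factors. A factor of a continuous action of $G$ on a compact metrizable space $X$ is a continuous action of $G$ on a compact metrizable space $Y$ together with a $G$-equivariant continuous surjective map $X\to Y$; it is nontrivial if $Y$ has more than one point. Sofic approximations. For $d\in\mathbb N$ write $[d]=\{1,\dots,d\}$ and $\mathrm{Sym}(d)$ for the permutation group of $[d]$. A sofic approximation sequence for a countable group $G$ is a sequence of maps $\Sigma=\{\sigma_i:G\to\mathrm{Sym}(d_i)\}_{i=1}^\infty$ such that: (1) for all $s,t\in G$, $\lim_i |\{a\in[d_i]:\sigma_i(s)\sigma_i(t)(a)=\sigma_i(st)(a)\}|/d_i=1$; (2) for all distinct $s,t\in G$, $\lim_i|\{a\in[d_i]:\sigma_i(s)(a)=\sigma_i(t)(a)\}|/d_i=0$; (3) $\lim_i d_i=+\infty$. $G$ is sofic if it has such a sequence. We write $\sigma_s=\sigma(s)$. Order and $\mathcal D$. For finite open covers of a compact space $Y$, $\mathcal V\succ\mathcal U$ means every element of $\mathcal V$ is contained in some element of $\mathcal U$. Put $\mathrm{ord}(\mathcal U)=\max_{y\in Y}\sum_{U\in\mathcal U}1_U(y)-1$ and $\mathcal D(\mathcal U)=\min_{\mathcal V\succ\mathcal U}\mathrm{ord}(\mathcal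 V)$, the minimum over finite open covers $\mathcal V$ of $Y$ refining $\mathcal U$. Sofic mean topological dimension. Let $G$ act continuously on a compact metrizable space $Y$ by $\alpha$, and let $\rho$ be a compatible metric on $Y$. For maps $\varphi,\psi:[d]\to Y$ put $\rho_2(\varphi,\psi)=\big(\frac1d\sum_{a\in[d]}\rho(\varphi(a),\psi(a))^2\big)^{1/2}$. For a nonempty finite $F\subseteq G$, $\delta>0$, and a map $\sigma:G\to\mathrm{Sym}(d)$, $\mathrm{Map}(\rho,F,\delta,\sigma)$ is the set of all $\varphi:[d]\to Y$ with $\rho_2(\varphi\circ\sigma_s,\alpha_s\circ\varphi)\le\delta$ for all $s\in F$, a closed subspace of $Y^{[d]}$. For a finite open cover $\mathcal U$ of $Y$, $\mathcal U^d$ is the open cover of $Y^{[d]}$ by the sets $U_1\times\cdots\times U_d$, $U_j\in\mathcal U$. Let $\mathcal D(\mathcal U,\rho,F,\delta,\sigma)=\mathcal D(\mathcal U^d|_{\mathrm{Map}(\rho,F,\delta,\sigma)})$, where $|$ denotes the restricted cover. Put $\mathcal D_\Sigma(\mathcal U,\rho,F,\delta)=\varlimsup_{i\to\infty}\mathcal D(\mathcal U,\rho,F,\delta,\sigma_i)/d_i$, set to $-\infty$ if $\mathrm{Map}(\rho,F,\delta,\sigma_i)$ is empty for all sufficiently large $i$; $\mathcal D_\Sigma(\mathcal U)=\inf_F\inf_{\delta>0}\mathcal D_\Sigma(\mathcal U,\rho,F,\delta)$ over nonempty finite $F\subseteq G$ and $\delta>0$ (this does not depend on the choice of $\rho$);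 and $\mathrm{mdim}_\Sigma(Y)=\sup_{\mathcal U}\mathcal D_\Sigma(\mathcal U)$ over finite open covers $\mathcal U$ of $Y$. *)

theory Defs
  imports "HOL-Analysis.Analysis" "HOL-Algebra.Group_Action"
begin

text \<open>A group is a HOL-Algebra group with discrete topology, so an action is continuous iff every
  group element acts continuously.\<close>

definition continuous_action ::
  "('g, 'm) monoid_scheme \<Rightarrow> 'a topology \<Rightarrow> ('g \<Rightarrow> 'a \<Rightarrow> 'a) \<Rightarrow> bool" where
  "continuous_action G X \<alpha> \<longleftrightarrow>
     group_action G (topspace X) \<alpha> \<and> (\<forall>s\<in>carrier G. continuous_map X X (\<alpha> s))"

definition is_factor ::
  "('g, 'm) monoid_scheme \<Rightarrow> 'a topology \<Rightarrow> ('g \<Rightarrow> 'a \<Rightarrow> 'a) \<Rightarrow>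
     'b topology \<Rightarrow> ('g \<Rightarrow> 'b \<Rightarrow> 'b) \<Rightarrow> ('a \<Rightarrow> 'b) \<Rightarrow> bool" where
  "is_factor G X \<alpha> Y \<beta> \<pi> \<longleftrightarrow>
     compact_space Y \<and> metrizable_space Y \<and> continuous_action G Y \<beta> \<and>
     continuous_map X Y \<pi> \<and> \<pi> ` topspace X = topspace Y \<and>
     (\<forall>s\<in>carrier G. \<forall>x\<in>topspace X. \<pi> (\<alpha> s x) = \<beta> s (\<pi> x))"

definition nontrivial_space :: "'a topology \<Rightarrow> bool" where
  "nontrivial_space Y \<longleftrightarrow> (\<exists>y\<in>topspace Y. \<exists>y'\<in>topspace Y. y \<noteq> y')"

definition shift_space :: "('g, 'm) monoid_scheme \<Rightarrow> 'z topology \<Rightarrow> ('g \<Rightarrow> 'z) topology" where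
  "shift_space G Z = product_topology (\<lambda>_. Z) (carrier G)"

definition left_shift ::
  "('g, 'm) monoid_scheme \<Rightarrow> 'z topology \<Rightarrow> 'g \<Rightarrow> ('g \<Rightarrow> 'z) \<Rightarrow> ('g \<Rightarrow> 'z)" where
  "left_shift G Z s =
     (\<lambda>x\<in>topspace (shift_space G Z). \<lambda>t\<in>carrier G. x (inv\<^bsub>G\<^esub> s \<otimes>\<^bsub>G\<^esub> t))"

definition sofic_approximation ::
  "('g, 'm) monoid_scheme \<Rightarrow> (nat \<Rightarrow> nat) \<Rightarrow> (nat \<Rightarrow> 'g \<Rightarrow> nat \<Rightarrow> nat) \<Rightarrow> bool" where
  "sofic_approximation G d \<sigma> \<longleftrightarrow>
     (\<forall>i. 0 < d i) \<and>
     (\<forall>i. \<forall>s\<in>carrier G. \<sigma> i s permutes {1..d i}) \<and>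
     (\<forall>s\<in>carrier G. \<forall>t\<in>carrier G.
        (\<lambda>i. real (card {a \<in> {1..d i}. \<sigma> i s (\<sigma> i t a) = \<sigma> i (s \<otimes>\<^bsub>G\<^esub> t) a}) / real (d i))
          \<longlonglongrightarrow> 1) \<and>
     (\<forall>s\<in>carrier G. \<forall>t\<in>carrier G. s \<noteq> t \<longrightarrow>
        (\<lambda>i. real (card {a \<in> {1..d i}. \<sigma> i s a = \<sigma> i t a}) / real (d i)) \<longlonglongrightarrow> 0) \<and>
     filterlim d at_top sequentially"

definition finite_open_cover :: "'a topology \<Rightarrow> 'a set set \<Rightarrow> bool" where
  "finite_open_cover Y \<U> \<longleftrightarrow> finite \<U> \<and> (\<forall>U\<in>\<U>. openin Y U) \<and> \<Union>\<U> = topspace Y"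

definition refines :: "'a set set \<Rightarrow> 'a set set \<Rightarrow> bool" where
  "refines \<V> \<U> \<longleftrightarrow> (\<forall>V\<in>\<V>. \<exists>U\<in>\<U>. V \<subseteq> U)"

text \<open>The value \<open>-1\<close> on the empty space is a convention; see \<open>mdim_cover_at\<close> below.\<close>

definition cover_ord :: "'a topology \<Rightarrow> 'a set set \<Rightarrow> int" where
  "cover_ord Y \<U> =
     (if topspace Y = {} then - 1
      else int (Max ((\<lambda>y. card {U \<in> \<U>. y \<in> U}) ` topspace Y)) - 1)"

text \<open>All values of \<^const>\<open>cover_ord\<close> on covers are integers \<open>\<ge> -1\<close>, so the infimum is a minimum.\<close>

definition cover_dim :: "'a topology \<Rightarrow> 'a set set \<Rightarrow> int" where
  "cover_dim Y \<U> = Inf {cover_ord Y \<V> | \<V>. finite_open_cover Y \<V> \<and> refines \<V> \<U>}"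

definition rho2 :: "'b metric \<Rightarrow> nat \<Rightarrow> (nat \<Rightarrow> 'b) \<Rightarrow> (nat \<Rightarrow> 'b) \<Rightarrow> real" where
  "rho2 \<rho> n \<phi> \<psi> = sqrt ((\<Sum>a\<in>{1..n}. (mdist \<rho> (\<phi> a) (\<psi> a))\<^sup>2) / real n)"

definition Map_set ::
  "'b topology \<Rightarrow> ('g \<Rightarrow> 'b \<Rightarrow> 'b) \<Rightarrow> 'b metric \<Rightarrow> 'g set \<Rightarrow> real \<Rightarrow> nat \<Rightarrow> ('g \<Rightarrow> nat \<Rightarrow> nat) \<Rightarrow>
     (nat \<Rightarrow> 'b) set" where
  "Map_set Y \<beta> \<rho> F \<delta> n \<sigma> =
     {\<phi> \<in> {1..n} \<rightarrow>\<^sub>E topspace Y. \<forall>s\<in>F. rho2 \<rho> n (\<phi> \<circ> \<sigma> s) (\<beta> s \<circ> \<phi>) \<le> \<delta>}"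

definition Map_space ::
  "'b topology \<Rightarrow> ('g \<Rightarrow> 'b \<Rightarrow> 'b) \<Rightarrow> 'b metric \<Rightarrow> 'g set \<Rightarrow> real \<Rightarrow> nat \<Rightarrow> ('g \<Rightarrow> nat \<Rightarrow> nat) \<Rightarrow>
     (nat \<Rightarrow> 'b) topology" where
  "Map_space Y \<beta> \<rho> F \<delta> n \<sigma> =
     subtopology (product_topology (\<lambda>_. Y) {1..n}) (Map_set Y \<beta> \<rho> F \<delta> n \<sigma>)"

definition power_cover :: "nat \<Rightarrow> 'b set set \<Rightarrow> (nat \<Rightarrow> 'b) set set" where
  "power_cover n \<U> = {PiE {1..n} u | u. u \<in> {1..n} \<rightarrow> \<U>}"

definition restrict_cover :: "'a set set \<Rightarrow> 'a set \<Rightarrow> 'a set set" where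
  "restrict_cover \<U> A = (\<lambda>U. U \<inter> A) ` \<U>"

definition Map_dim ::
  "'b topology \<Rightarrow> ('g \<Rightarrow> 'b \<Rightarrow> 'b) \<Rightarrow> 'b set set \<Rightarrow> 'b metric \<Rightarrow> 'g set \<Rightarrow> real \<Rightarrow>
     nat \<Rightarrow> ('g \<Rightarrow> nat \<Rightarrow> nat) \<Rightarrow> int" where
  "Map_dim Y \<beta> \<U> \<rho> F \<delta> n \<sigma> =
     cover_dim (Map_space Y \<beta> \<rho> F \<delta> n \<sigma>)
       (restrict_cover (power_cover n \<U>) (Map_set Y \<beta> \<rho> F \<delta> n \<sigma>))"

text \<open>If infinitely many of the mapping spaces are nonempty, these contribute nonnegative terms to
  the upper limit, so the negative convention for empty ones does not affect it.\<close>

definition mdim_cover_at ::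
  "(nat \<Rightarrow> nat) \<Rightarrow> (nat \<Rightarrow> 'g \<Rightarrow> nat \<Rightarrow> nat) \<Rightarrow> 'b topology \<Rightarrow> ('g \<Rightarrow> 'b \<Rightarrow> 'b) \<Rightarrow>
     'b set set \<Rightarrow> 'b metric \<Rightarrow> 'g set \<Rightarrow> real \<Rightarrow> ereal" where
  "mdim_cover_at d \<sigma> Y \<beta> \<U> \<rho> F \<delta> =
     (if \<forall>\<^sub>F i in sequentially. Map_set Y \<beta> \<rho> F \<delta> (d i) (\<sigma> i) = {} then - \<infinity>
      else limsup (\<lambda>i. ereal (real_of_int (Map_dim Y \<beta> \<U> \<rho> F \<delta> (d i) (\<sigma> i)) / real (d i))))"

definition mdim_cover ::
  "('g, 'm) monoid_scheme \<Rightarrow> (nat \<Rightarrow> nat) \<Rightarrow> (nat \<Rightarrow> 'g \<Rightarrow> nat \<Rightarrow> nat) \<Rightarrow>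
     'b topology \<Rightarrow> ('g \<Rightarrow> 'b \<Rightarrow> 'b) \<Rightarrow> 'b metric \<Rightarrow> 'b set set \<Rightarrow> ereal" where
  "mdim_cover G d \<sigma> Y \<beta> \<rho> \<U> =
     (INF F\<in>{F. finite F \<and> F \<noteq> {} \<and> F \<subseteq> carrier G}. INF \<delta>\<in>{0<..}.
        mdim_cover_at d \<sigma> Y \<beta> \<U> \<rho> F \<delta>)"

text \<open>The metric \<open>\<rho>\<close> is meant to satisfy \<open>mtopology_of \<rho> = Y\<close>.\<close>

definition sofic_mdim ::
  "('g, 'm) monoid_scheme \<Rightarrow> (nat \<Rightarrow> nat) \<Rightarrow> (nat \<Rightarrow> 'g \<Rightarrow> nat \<Rightarrow> nat) \<Rightarrow>
     'b topology \<Rightarrow> ('g \<Rightarrow> 'b \<Rightarrow> 'b) \<Rightarrow> 'b metric \<Rightarrow> ereal" where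
  "sofic_mdim G d \<sigma> Y \<beta> \<rho> = (SUP \<U>\<in>{\<U>. finite_open_cover Y \<U>}. mdim_cover G d \<sigma> Y \<beta> \<rho> \<U>)"

end

theory Submission
  imports Defs
begin

text \<open>Since \<open>\<pi>\<close> is uniformly continuous on \<open>Z\<^sup>G\<close>, it depends up to any error on finitely many
  coordinates; hence, being nonconstant, it separates two points \<open>v\<close>, \<open>w\<close> differing at a single
  coordinate \<open>g\<close>, which a path in \<open>Z\<close> joins. For a good sofic map \<open>\<sigma>\<close> on \<open>[d]\<close>, every
  \<open>z : [d] \<rightarrow> Z\<close> yields an approximately equivariant map \<open>a \<mapsto> \<pi> (t \<mapsto> z (\<sigma>(t\<inverse>) a))\<close>. Choosing
  \<open>A \<subseteq> [d]\<close> of positive density whose finite windows are disjoint, copying \<open>v\<close> into every window and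
  moving its \<open>g\<close>-entry along the path independently for each \<open>a \<in> A\<close>, one obtains a cube
  \<open>[0,1]\<^sup>A\<close> in the mapping space. The cover of \<open>Y\<close> by the complements of small balls around
  \<open>\<pi> v\<close> and \<open>\<pi> w\<close> pulls back to a cover of this cube none of whose members meets two opposite
  faces, so by Lebesgue's covering theorem every refinement has order at least \<open>|A|\<close>.\<close>

subsection \<open>Lebesgue's covering theorem for cubes\<close>

text \<open>The metric on functions over a countable type sums the coordinate distances, truncated
  at 1, with weights \<open>(1/2)^n\<close>; the factor 2 is the total weight.\<close>

lemma dist_fun_le_of_coordinates:
  fixes x y :: "nat \<Rightarrow> real"
  assumes "\<And>i. \<bar>x i - y i\<bar> \<le> e"
  shows "dist x y \<le> 2 * e"
proof -
  have sm: "summable (\<lambda>n. (1/2::real)^n * e)"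
    by (intro summable_mult2 summable_geometric) auto
  have le: "(1/2::real)^n * min (dist (x (from_nat n)) (y (from_nat n))) 1 \<le> (1/2)^n * e" for n
    using assms[of "from_nat n"] by (intro mult_left_mono) (auto simp: dist_real_def min_le_iff_disj)
  have "summable (\<lambda>n. (1/2::real)^n * min (dist (x (from_nat n)) (y (from_nat n))) 1)"
    by (rule summable_comparison_test'[OF sm, of 0]) (use le in auto)
  then have "dist x y \<le> (\<Sum>n. (1/2::real)^n * e)"
    unfolding dist_fun_def by (intro suminf_le le sm)
  also have "\<dots> = (\<Sum>n. (1/2::real)^n) * e"
    by (intro suminf_mult2[symmetric] summable_geometric) auto
  also have "\<dots> = 2 * e" by (subst suminf_geometric) auto
  finally show ?thesis .
qed

definition hilbert_cube :: "(nat \<Rightarrow> real) set" where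
  "hilbert_cube = {u. \<forall>i. u i \<in> {0..1}}"

lemma compact_hilbert_cube: "compact hilbert_cube"
proof -
  have "compactin (product_topology (\<lambda>_::nat. euclideanreal) UNIV) (PiE UNIV (\<lambda>_. {0..1}))"
    by (subst compactin_PiE) auto
  moreover have "PiE UNIV (\<lambda>_. {0..1}) = hilbert_cube"
    by (auto simp: hilbert_cube_def)
  ultimately show ?thesis
    by (simp add: euclidean_product_topology)
qed

text \<open>Labelling each point of a fine grid by a member of the cover containing a whole Lebesgue
  ball around it, the vertices of a completely labelled Kuhn simplex choose pairwise distinct
  members, all of which contain the entire simplex. Using the Hilbert cube in place of a
  finite-dimensional one keeps the dimension \<open>n\<close> out of the type.\<close>

lemma lebesgue_covering_cube:
  fixes V :: "'i \<Rightarrow> (nat \<Rightarrow> real) set"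
  assumes opn: "\<And>j. j \<in> I \<Longrightarrow> openin (top_of_set hilbert_cube) (V j)"
    and cov: "hilbert_cube \<subseteq> (\<Union>j\<in>I. V j)"
    and faces: "\<And>i j. i < n \<Longrightarrow> j \<in> I \<Longrightarrow> (\<forall>u\<in>V j. u i \<noteq> 0) \<or> (\<forall>u\<in>V j. u i \<noteq> 1)"
  shows "\<exists>u\<in>hilbert_cube. \<exists>J\<subseteq>I. card J = Suc n \<and> (\<forall>j\<in>J. u \<in> V j)"
proof -
  \<comment> \<open>Balls around points of the cube stick out of it, so the Lebesgue number is taken
    for open sets \<open>T j\<close> of the whole space that cut out the \<open>V j\<close>.\<close>
  obtain T where T: "\<And>j. j \<in> I \<Longrightarrow> open (T j) \<and> V j = hilbert_cube \<inter> T j"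
    using opn unfolding openin_open by metis
  obtain \<epsilon> where \<epsilon>: "\<epsilon> > 0" "\<And>x. x \<in> hilbert_cube \<Longrightarrow> \<exists>B \<in> T ` I. ball x \<epsilon> \<subseteq> B"
  proof (rule Heine_Borel_lemma[OF compact_hilbert_cube, of "T ` I"])
    fix e :: real
    assume "0 < e" "\<And>x. x \<in> hilbert_cube \<Longrightarrow> \<exists>B\<in>T ` I. ball x e \<subseteq> B"
    then show thesis by (rule that)
  next
    show "hilbert_cube \<subseteq> \<Union> (T ` I)"
    proof
      fix x assume "x \<in> hilbert_cube"
      then obtain j where "j \<in> I" "x \<in> V j" using cov by blast
      then show "x \<in> \<Union> (T ` I)" using T[of j] by blast
    qed
    show "open B" if "B \<in> T ` I" for B using that T by blast
  qed
  have "\<forall>x\<in>hilbert_cube. \<exists>j. j \<in> I \<and> ball x \<epsilon> \<subseteq> T j"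
    using \<epsilon>(2) by blast
  then obtain jj where jj: "\<And>x. x \<in> hilbert_cube \<Longrightarrow> jj x \<in> I \<and> ball x \<epsilon> \<subseteq> T (jj x)"
    unfolding bchoice_iff by blast
  have jjV: "x \<in> V (jj x)" if "x \<in> hilbert_cube" for x
  proof -
    have "jj x \<in> I" "ball x \<epsilon> \<subseteq> T (jj x)" using jj[OF that] by auto
    moreover have "x \<in> ball x \<epsilon>" using \<epsilon>(1) by simp
    ultimately show ?thesis using T[of "jj x"] that by blast
  qed
  \<comment> \<open>Vertices of one Kuhn simplex differ by at most one grid step \<open>1/p\<close>
    per coordinate, hence by at most \<open>2/p\<close> in the metric.\<close>
  obtain p :: nat where p: "p > 0" "2 / real p < \<epsilon>"
  proof -
    obtain p where "2 / \<epsilon> < real p" using reals_Archimedean2 by blast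
    moreover from this have "p > 0" using \<epsilon>(1) by (cases "p = 0") (auto simp: field_simps)
    ultimately show ?thesis using \<epsilon>(1) by (intro that[of p]) (auto simp: field_simps)
  qed
  define grid where "grid = (\<lambda>(x::nat \<Rightarrow> nat) i. real (x i) / real p)"
  \<comment> \<open>The label depends only on the chosen member: bit \<open>i\<close> records
    whether the member meets the face where coordinate \<open>i\<close> is 1. If the member contains
    a point with coordinate 0, \<open>faces\<close> forces the bit to be 0, which gives the boundary
    conditions of Kuhn's lemma.\<close>
  define h where "h j i = (if \<exists>u\<in>V j. u i = 1 then 1 else 0 :: nat)" for j i
  define lab where "lab x = h (jj (grid x))" for x
  have grid: "grid x \<in> hilbert_cube" if "\<forall>j. x j \<le> p" for x
    using that p(1) by (auto simp: grid_def hilbert_cube_def)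
  have "odd (card {s. ksimplex p n s \<and> (reduced n \<circ> lab) ` s = {..n}})"
  proof (rule kuhn_combinatorial[OF p(1)]; intro allI impI; elim conjE)
    fix x :: "nat \<Rightarrow> nat" and j assume x: "\<forall>j. x j \<le> p" "j < n"
    note * = jj[OF grid[OF x(1)]] jjV[OF grid[OF x(1)]]
    show "lab x j = 0" if "x j = 0"
    proof -
      have "grid x j = 0" using that by (simp add: grid_def)
      then show ?thesis using faces[OF x(2), of "jj (grid x)"] * by (auto simp: lab_def h_def)
    qed
    show "lab x j = 1" if "x j = p"
    proof -
      have "grid x j = 1" using that p by (simp add: grid_def)
      then show ?thesis using * by (auto simp: lab_def h_def)
    qed
  qed
  then obtain s where s: "ksimplex p n s" and rl: "(reduced n \<circ> lab) ` s = {..n}"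
    using odd_card_imp_not_empty by blast
  then obtain b upd where "kuhn_simplex p n b upd s"
    by (auto elim: ksimplex.cases)
  interpret kuhn_simplex p n b upd s by fact
  have sQ: "grid a \<in> hilbert_cube" if "a \<in> s" for a
    using s_le_p[OF that] grid by blast
  define J where "J = (jj \<circ> grid) ` s"
  have fins: "finite s" "card s = Suc n"
    using ksimplex_card[OF s] by (auto intro: card_ge_0_finite)
  \<comment> \<open>Reduced labels factor through the chosen members, so \<open>n + 1\<close>
    different labels need \<open>n + 1\<close> different members.\<close>
  have "{..n} = (reduced n \<circ> h) ` J"
    unfolding rl[symmetric] J_def lab_def by (auto simp: image_comp)
  then have "card {..n} \<le> card J"
    using fins by (metis J_def card_image_le finite_imageI)
  moreover have "card J \<le> Suc n"
    using fins unfolding J_def by (metis card_image_le)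
  ultimately have "card J = Suc n" by simp
  moreover have "J \<subseteq> I" using jj sQ by (auto simp: J_def)
  \<comment> \<open>The base vertex is the common point: every vertex exceeds it by 0 or 1 in each
    coordinate, so it lies in the Lebesgue ball around each vertex.\<close>
  moreover have "grid b \<in> V j" if j: "j \<in> J" for j
  proof -
    obtain a where a: "a \<in> s" "j = jj (grid a)" using j by (auto simp: J_def)
    have "\<bar>grid a i - grid b i\<bar> \<le> 1 / p" for i
    proof -
      have "real (a i) \<le> real (b i) + 1" "real (b i) \<le> real (a i)"
        using le_Suc_base[OF a(1), of i] base_le[OF a(1), of i] by linarith+
      then have "\<bar>real (a i) - real (b i)\<bar> / p \<le> 1 / p"
        by (intro divide_right_mono) auto
      then show ?thesis by (simp add: grid_def flip: diff_divide_distrib)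
    qed
    then have "dist (grid a) (grid b) \<le> 2 * (1 / p)"
      by (rule dist_fun_le_of_coordinates)
    then have "grid b \<in> ball (grid a) \<epsilon>" using p by simp
    then show ?thesis
      using jj[OF sQ[OF a(1)]] T[of j] sQ[OF base_in_s] a by auto
  qed
  ultimately show ?thesis using sQ[OF base_in_s] by blast
qed

text \<open>Any refinement of \<U> inherits the face condition, so its preimages under
  \<open>f\<close> satisfy the covering theorem. A point of the cube in \<open>n + 1\<close>
  preimages maps to a point of multiplicity at least \<open>n + 1\<close>, and the order is the
  maximal multiplicity minus 1.\<close>

lemma cover_dim_ge_of_cube:
  assumes \<U>: "finite_open_cover M \<U>"
    and f: "continuous_map (top_of_set hilbert_cube) M f"
    and faces: "\<And>i U. i < n \<Longrightarrow> U \<in> \<U> \<Longrightarrow>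
      (\<forall>u\<in>hilbert_cube. u i = 0 \<longrightarrow> f u \<notin> U) \<or> (\<forall>u\<in>hilbert_cube. u i = 1 \<longrightarrow> f u \<notin> U)"
  shows "int n \<le> cover_dim M \<U>"
proof -
  have "int n \<le> cover_ord M \<V>" if \<V>: "finite_open_cover M \<V>" "refines \<V> \<U>" for \<V>
  proof -
    have fM: "f u \<in> topspace M" if "u \<in> hilbert_cube" for u
      using f that unfolding continuous_map_def by auto
    \<comment> \<open>The preimages are indexed by the members \<open>W\<close> themselves, so that
      different members with equal preimages still count separately.\<close>
    have "\<exists>u\<in>hilbert_cube. \<exists>J\<subseteq>\<V>. card J = Suc n \<and> (\<forall>W\<in>J. u \<in> {u \<in> hilbert_cube. f u \<in> W})"
    proof (rule lebesgue_covering_cube)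
      fix W assume W: "W \<in> \<V>"
      then have "openin M W" using \<V>(1) by (auto simp: finite_open_cover_def)
      then show "openin (top_of_set hilbert_cube) {u \<in> hilbert_cube. f u \<in> W}"
        using openin_continuous_map_preimage[OF f] by simp
      fix i assume i: "i < n"
      obtain U where "U \<in> \<U>" "W \<subseteq> U" using \<V>(2) W by (auto simp: refines_def)
      then show "(\<forall>u\<in>{u \<in> hilbert_cube. f u \<in> W}. u i \<noteq> 0) \<or> (\<forall>u\<in>{u \<in> hilbert_cube. f u \<in> W}. u i \<noteq> 1)"
        using faces[OF i] by blast
    next
      show "hilbert_cube \<subseteq> (\<Union>W\<in>\<V>. {u \<in> hilbert_cube. f u \<in> W})"
        using fM \<V>(1) by (auto simp: finite_open_cover_def)
    qed
    then obtain u J where u: "u \<in> hilbert_cube" "J \<subseteq> \<V>" "card J = Suc n" "\<forall>W\<in>J. f u \<in> W" by blast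
    have fin: "finite \<V>" using \<V>(1) by (simp add: finite_open_cover_def)
    let ?c = "\<lambda>y. card {W \<in> \<V>. y \<in> W}"
    have "?c ` topspace M \<subseteq> {..card \<V>}" using fin by (auto intro: card_mono)
    then have "finite (?c ` topspace M)" using finite_subset by blast
    then have "?c (f u) \<le> Max (?c ` topspace M)" using fM[OF u(1)] by (intro Max_ge) auto
    moreover have "card J \<le> ?c (f u)" using u fin by (intro card_mono) auto
    ultimately show ?thesis using u(3) fM[OF u(1)] by (auto simp: cover_ord_def)
  qed
  \<comment> \<open>This makes the set of orders nonempty, without which the integer infimum would
    be uncontrolled.\<close>
  moreover have "refines \<U> \<U>" by (auto simp: refines_def)
  ultimately show ?thesis unfolding cover_dim_def using \<U> by (intro cInf_greatest) auto
qed

lemma finite_open_cover_Map_space: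
  assumes "finite_open_cover Y \<U>"
  shows "finite_open_cover (Map_space Y \<beta> \<rho> F \<delta> n \<sigma>)
           (restrict_cover (power_cover n \<U>) (Map_set Y \<beta> \<rho> F \<delta> n \<sigma>))"
proof -
  let ?M = "Map_set Y \<beta> \<rho> F \<delta> n \<sigma>"
  let ?P = "product_topology (\<lambda>_. Y) {1..n}"
  have sub: "?M \<subseteq> topspace ?P" by (auto simp: Map_set_def)
  \<comment> \<open>\<open>power_cover\<close> ranges over infinitely many functions on the
    naturals; restricting them to \<open>{1..n}\<close> exhibits it as the image of a finite
    set.\<close>
  have "power_cover n \<U> = (\<lambda>u. PiE {1..n} u) ` ({1..n} \<rightarrow>\<^sub>E \<U>)"
  proof (intro equalityI subsetI)
    fix S assume "S \<in> power_cover n \<U>"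
    then obtain u where u: "S = PiE {1..n} u" "u \<in> {1..n} \<rightarrow> \<U>" by (auto simp: power_cover_def)
    have "PiE {1..n} (restrict u {1..n}) = PiE {1..n} u" by (rule PiE_cong) simp
    then have "S = PiE {1..n} (restrict u {1..n})" "restrict u {1..n} \<in> {1..n} \<rightarrow>\<^sub>E \<U>"
      using u by auto
    then show "S \<in> (\<lambda>u. PiE {1..n} u) ` ({1..n} \<rightarrow>\<^sub>E \<U>)" by blast
  qed (auto simp: power_cover_def)
  then have fin: "finite (power_cover n \<U>)"
    using assms by (auto simp: finite_open_cover_def intro!: finite_imageI finite_PiE)
  have opn: "openin ?P S" if "S \<in> power_cover n \<U>" for S
    using that assms by (auto simp: power_cover_def openin_PiE_gen finite_open_cover_def Pi_iff)
  have cov: "topspace ?P \<subseteq> \<Union>(power_cover n \<U>)"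
  proof
    fix \<phi> assume \<phi>: "\<phi> \<in> topspace ?P"
    then have "\<forall>a\<in>{1..n}. \<exists>U. U \<in> \<U> \<and> \<phi> a \<in> U"
      using assms by (fastforce simp: finite_open_cover_def PiE_iff)
    then obtain u where "\<And>a. a \<in> {1..n} \<Longrightarrow> u a \<in> \<U> \<and> \<phi> a \<in> u a" unfolding bchoice_iff by blast
    then have "\<phi> \<in> PiE {1..n} u" "u \<in> {1..n} \<rightarrow> \<U>" using \<phi> by (auto simp: PiE_iff)
    then show "\<phi> \<in> \<Union>(power_cover n \<U>)" by (auto simp: power_cover_def)
  qed
  show ?thesis
    unfolding finite_open_cover_def restrict_cover_def Map_space_def
  proof (intro conjI ballI)
    show "finite ((\<lambda>U. U \<inter> ?M) ` power_cover n \<U>)" using fin by simp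
    show "openin (subtopology ?P ?M) S" if "S \<in> (\<lambda>U. U \<inter> ?M) ` power_cover n \<U>" for S
      using that opn by (auto simp: openin_subtopology)
    show "\<Union> ((\<lambda>U. U \<inter> ?M) ` power_cover n \<U>) = topspace (subtopology ?P ?M)"
      using cov sub by (auto simp: topspace_subtopology simp del: topspace_product_topology)
  qed
qed

subsection \<open>Continuous maps on compact products\<close>

text \<open>By compactness finitely many basic boxes, each mapped into a ball of radius
  \<open>e/2\<close>, cover the product. \<open>K\<close> collects the finitely many coordinates
  that these boxes constrain; changing any other coordinate does not leave a box.\<close>

lemma continuous_map_product_finite_dependence:
  assumes comp: "compact_space (product_topology X I)"
    and f: "continuous_map (product_topology X I) (mtopology_of \<rho>) f"
    and e: "e > 0"
  obtains K where "finite K" "K \<subseteq> I"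
    "\<And>x y. \<lbrakk>x \<in> topspace (product_topology X I); y \<in> topspace (product_topology X I);
       \<forall>i\<in>K. x i = y i\<rbrakk> \<Longrightarrow> mdist \<rho> (f x) (f y) < e"
proof -
  define P where "P = product_topology X I"
  interpret M: Metric_space "mspace \<rho>" "mdist \<rho>" by blast
  have top: "M.mtopology = mtopology_of \<rho>" by (simp add: mtopology_of_def)
  have fM: "f x \<in> mspace \<rho>" if "x \<in> topspace P" for x
    using f that unfolding P_def continuous_map_def by auto
  define \<U> where "\<U> = {PiE I U | U. finite {i\<in>I. U i \<noteq> topspace (X i)} \<and> (\<forall>i\<in>I. openin (X i) (U i)) \<and>
      (\<exists>x\<in>topspace P. PiE I U \<subseteq> {y \<in> topspace P. f y \<in> M.mball (f x) (e/2)})}"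
  have "topspace P \<subseteq> \<Union>\<U>"
  proof
    fix x assume x: "x \<in> topspace P"
    have "openin P {y \<in> topspace P. f y \<in> M.mball (f x) (e/2)}"
      unfolding P_def by (rule openin_continuous_map_preimage[OF f]) (metis top M.openin_mball)
    moreover have "x \<in> {y \<in> topspace P. f y \<in> M.mball (f x) (e/2)}"
      using x fM[OF x] e by auto
    ultimately obtain U where U: "finite {i\<in>I. U i \<noteq> topspace (X i)}" "\<forall>i\<in>I. openin (X i) (U i)"
      "x \<in> PiE I U" "PiE I U \<subseteq> {y \<in> topspace P. f y \<in> M.mball (f x) (e/2)}"
      unfolding P_def openin_product_topology_alt by blast
    then have "PiE I U \<in> \<U>" unfolding \<U>_def using x by blast
    then show "x \<in> \<Union>\<U>" using U(3) by blast
  qed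
  moreover have "\<forall>S\<in>\<U>. openin P S"
    unfolding \<U>_def P_def by (auto simp: openin_PiE_gen)
  ultimately have "\<exists>\<F>. finite \<F> \<and> \<F> \<subseteq> \<U> \<and> topspace P \<subseteq> \<Union>\<F>"
    using comp[folded P_def, unfolded compact_space_alt, rule_format, of \<U>] by simp
  then obtain \<F> where F: "finite \<F>" "\<F> \<subseteq> \<U>" "topspace P \<subseteq> \<Union>\<F>"
    by blast
  have "\<forall>S\<in>\<F>. \<exists>U. S = PiE I U \<and> finite {i\<in>I. U i \<noteq> topspace (X i)} \<and>
      (\<exists>x\<in>topspace P. PiE I U \<subseteq> {y \<in> topspace P. f y \<in> M.mball (f x) (e/2)})"
  proof
    fix S assume "S \<in> \<F>"
    then have "S \<in> \<U>" using F(2) by blast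
    then show "\<exists>U. S = PiE I U \<and> finite {i\<in>I. U i \<noteq> topspace (X i)} \<and>
      (\<exists>x\<in>topspace P. PiE I U \<subseteq> {y \<in> topspace P. f y \<in> M.mball (f x) (e/2)})"
      unfolding \<U>_def mem_Collect_eq by (elim exE conjE) (intro exI conjI)
  qed
  from bchoice[OF this] obtain U where "\<forall>S\<in>\<F>. S = PiE I (U S) \<and> finite {i\<in>I. U S i \<noteq> topspace (X i)} \<and>
      (\<exists>x\<in>topspace P. PiE I (U S) \<subseteq> {y \<in> topspace P. f y \<in> M.mball (f x) (e/2)})"
    by (rule exE)
  note U = bspec[OF this]
  define K where "K = (\<Union>S\<in>\<F>. {i\<in>I. U S i \<noteq> topspace (X i)})"
  show ?thesis
  proof (rule that[of K])
    show "finite K" "K \<subseteq> I" using F(1) U[THEN conjunct2, THEN conjunct1] by (auto simp: K_def)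
    fix x y assume x: "x \<in> topspace (product_topology X I)" and y: "y \<in> topspace (product_topology X I)"
      and eq: "\<forall>i\<in>K. x i = y i"
    obtain S where S: "S \<in> \<F>" "x \<in> S" using F(3) x by (auto simp: P_def)
    obtain c where c: "c \<in> topspace P" "PiE I (U S) \<subseteq> {y \<in> topspace P. f y \<in> M.mball (f c) (e/2)}"
      using U[OF S(1)] by blast
    have xU: "x \<in> PiE I (U S)" using U[OF S(1)] S(2) by blast
    have "y i \<in> U S i" if "i \<in> I" for i
    proof (cases "i \<in> K")
      case True
      then show ?thesis using eq xU that by (metis PiE_mem)
    next
      case False
      then have "U S i = topspace (X i)" using S(1) that by (auto simp: K_def)
      then show ?thesis using y that by (auto simp: PiE_iff)
    qed
    then have "y \<in> PiE I (U S)" using y by (auto simp: PiE_iff)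
    then have "f x \<in> M.mball (f c) (e/2)" "f y \<in> M.mball (f c) (e/2)" using xU c(2) by blast+
    then show "mdist \<rho> (f x) (f y) < e"
      using M.triangle[of "f x" "f c" "f y"] by (auto simp: M.commute)
  qed
qed

text \<open>If single-coordinate changes never affected \<open>f\<close>, neither would finitely
  many of them, while finitely many coordinates determine \<open>f\<close> up to an error smaller
  than the distance from \<open>f x\<close> to \<open>f y\<close>.\<close>

lemma continuous_map_product_single_coordinate:
  assumes comp: "compact_space (product_topology X I)"
    and f: "continuous_map (product_topology X I) (mtopology_of \<rho>) f"
    and x: "x \<in> topspace (product_topology X I)" and y: "y \<in> topspace (product_topology X I)"
    and ne: "f x \<noteq> f y"
  obtains g v w where "g \<in> I" "v \<in> topspace (product_topology X I)"
    "w \<in> topspace (product_topology X I)" "\<forall>i\<in>I - {g}. v i = w i" "f v \<noteq> f w"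
proof (rule ccontr)
  assume "\<not> thesis"
  with that have inv: "f v = f w" if "g \<in> I" "v \<in> topspace (product_topology X I)"
    "w \<in> topspace (product_topology X I)" "\<forall>i\<in>I - {g}. v i = w i" for g v w
    using that by blast
  have fM: "f z \<in> mspace \<rho>" if "z \<in> topspace (product_topology X I)" for z
    using f that unfolding continuous_map_def by auto
  have pos: "mdist \<rho> (f x) (f y) > 0"
    using ne fM[OF x] fM[OF y] by (metis mdist_nonneg mdist_zero less_eq_real_def)
  obtain K where K: "finite K" "K \<subseteq> I"
    "\<And>v w. \<lbrakk>v \<in> topspace (product_topology X I); w \<in> topspace (product_topology X I);
       \<forall>i\<in>K. v i = w i\<rbrakk> \<Longrightarrow> mdist \<rho> (f v) (f w) < mdist \<rho> (f x) (f y)"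
    by (rule continuous_map_product_finite_dependence[OF comp f pos], rule that)
  \<comment> \<open>\<open>mix L\<close> passes from \<open>x\<close> to \<open>y\<close> as
    \<open>L\<close> grows by one coordinate at a time.\<close>
  define mix where "mix L = (\<lambda>i. if i \<in> L then y i else x i)" for L
  have mix: "mix L \<in> topspace (product_topology X I)" if "L \<subseteq> I" for L
    using x y that by (auto simp: mix_def PiE_iff extensional_def)
  have "f (mix K) = f x" using K(1,2)
  proof (induction K rule: finite_induct)
    case empty
    then show ?case by (simp add: mix_def)
  next
    case (insert k L)
    have "f (mix (insert k L)) = f (mix L)"
    proof (rule inv)
      show "k \<in> I" "mix (insert k L) \<in> topspace (product_topology X I)"
        "mix L \<in> topspace (product_topology X I)"
        using insert.prems by (auto intro!: mix simp del: topspace_product_topology)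
    qed (auto simp: mix_def)
    then show ?case using insert by simp
  qed
  \<comment> \<open>\<open>mix K\<close> agrees with \<open>y\<close> on \<open>K\<close>, so its
    value is closer to \<open>f y\<close> than \<open>f x\<close> is, although that value equals
    \<open>f x\<close>.\<close>
  moreover have "mdist \<rho> (f (mix K)) (f y) < mdist \<rho> (f x) (f y)"
    using K(2) mix y by (intro K(3)) (auto simp: mix_def)
  ultimately show False by simp
qed

subsection \<open>Models over a sofic approximation\<close>

text \<open>Take \<open>A\<close> maximal with pairwise disjoint windows, the window of
  \<open>a\<close> being the set of all \<open>w t a\<close> with \<open>t\<close> in
  \<open>K\<close>. By maximality the window of each \<open>b\<close> in \<open>B\<close> meets that
  of some \<open>a\<close> in \<open>A\<close>, say \<open>w s a = w t b\<close>, and injectivity of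
  \<open>w t\<close> recovers \<open>b\<close> from the triple \<open>(s, t, a)\<close>.\<close>

lemma separated_windows:
  fixes w :: "'t \<Rightarrow> 'a \<Rightarrow> 'b"
  assumes "finite B" "finite K" "K \<noteq> {}" and inj: "\<And>t. t \<in> K \<Longrightarrow> inj_on (w t) B"
  obtains A where "A \<subseteq> B" "card B \<le> (card K)\<^sup>2 * card A"
    "\<And>a b s t. \<lbrakk>a \<in> A; b \<in> A; s \<in> K; t \<in> K; w s a = w t b\<rbrakk> \<Longrightarrow> a = b"
proof -
  define sep where "sep A \<longleftrightarrow> A \<subseteq> B \<and> (\<forall>a\<in>A. \<forall>b\<in>A. \<forall>s\<in>K. \<forall>t\<in>K. w s a = w t b \<longrightarrow> a = b)" for A
  have "finite {A. sep A}"
    by (rule finite_subset[of _ "Pow B"]) (use assms in \<open>auto simp: sep_def\<close>)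
  moreover have "sep {}" by (simp add: sep_def)
  ultimately obtain A where A: "sep A" "\<And>A'. sep A' \<Longrightarrow> A \<subseteq> A' \<Longrightarrow> A = A'"
    using finite_has_maximal[of "{A. sep A}"] by (metis (mono_tags) empty_iff mem_Collect_eq)
  have AB: "A \<subseteq> B" and sepA: "\<And>a b s t. \<lbrakk>a \<in> A; b \<in> A; s \<in> K; t \<in> K; w s a = w t b\<rbrakk> \<Longrightarrow> a = b"
    using A(1) unfolding sep_def by blast+
  have finA: "finite A" using AB assms(1) finite_subset by blast
  have "B \<subseteq> (\<lambda>((s, t), a). inv_into B (w t) (w s a)) ` ((K \<times> K) \<times> A)"
  proof
    fix b assume b: "b \<in> B"
    have "\<exists>a\<in>A. \<exists>s\<in>K. \<exists>t\<in>K. w s a = w t b"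
    proof (cases "b \<in> A")
      case True
      then show ?thesis using \<open>K \<noteq> {}\<close> by blast
    next
      case False
      \<comment> \<open>A violation of separation must involve \<open>b\<close>, since
        \<open>A\<close> alone is separated.\<close>
      then have "\<not> sep (insert b A)" using A(2)[of "insert b A"] by blast
      then obtain a a' s t where *: "a \<in> insert b A" "a' \<in> insert b A" "s \<in> K" "t \<in> K"
          "w s a = w t a'" "a \<noteq> a'"
        using AB b unfolding sep_def by blast
      then show ?thesis using sepA by (metis insertE)
    qed
    then obtain a s t where "a \<in> A" "s \<in> K" "t \<in> K" "w s a = w t b" by blast
    moreover from this have "b = inv_into B (w t) (w s a)" using inj[of t] b by simp
    ultimately show "b \<in> (\<lambda>((s, t), a). inv_into B (w t) (w s a)) ` ((K \<times> K) \<times> A)"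
      by (intro image_eqI[of _ _ "((s,t),a)"]) auto
  qed
  then have "card B \<le> card ((K \<times> K) \<times> A)"
    using assms(2) finA by (meson card_mono card_image_le finite_SigmaI finite_imageI le_trans)
  then have "card B \<le> (card K)\<^sup>2 * card A"
    by (simp add: card_cartesian_product power2_eq_square)
  then show ?thesis using that AB sepA by blast
qed

lemma density_bex_tendsto_0:
  assumes "finite J"
    and "\<And>j. j \<in> J \<Longrightarrow> (\<lambda>i. real (card {a \<in> {1..d i}. P j i a}) / real (d i)) \<longlonglongrightarrow> 0"
  shows "(\<lambda>i. real (card {a \<in> {1..d i :: nat}. \<exists>j\<in>J. P j i a}) / real (d i)) \<longlonglongrightarrow> 0"
proof (rule tendsto_sandwich[of "\<lambda>_. 0" _ _ "\<lambda>i. \<Sum>j\<in>J. real (card {a \<in> {1..d i}. P j i a}) / real (d i)"])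
  show "(\<lambda>i. \<Sum>j\<in>J. real (card {a \<in> {1..d i}. P j i a}) / real (d i)) \<longlonglongrightarrow> 0"
    by (rule tendsto_null_sum) (use assms in auto)
  have "real (card {a \<in> {1..d i}. \<exists>j\<in>J. P j i a}) / real (d i)
      \<le> (\<Sum>j\<in>J. real (card {a \<in> {1..d i}. P j i a}) / real (d i))" for i
  proof -
    have "{a \<in> {1..d i}. \<exists>j\<in>J. P j i a} = (\<Union>j\<in>J. {a \<in> {1..d i}. P j i a})" by blast
    then have "card {a \<in> {1..d i}. \<exists>j\<in>J. P j i a} \<le> (\<Sum>j\<in>J. card {a \<in> {1..d i}. P j i a})"
      by (simp add: card_UN_le[OF assms(1)])
    then have "real (card {a \<in> {1..d i}. \<exists>j\<in>J. P j i a}) \<le> (\<Sum>j\<in>J. real (card {a \<in> {1..d i}. P j i a}))"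
      by (simp flip: of_nat_sum)
    then show ?thesis by (simp add: divide_right_mono flip: sum_divide_distrib)
  qed
  then show "\<forall>\<^sub>F i in sequentially. real (card {a \<in> {1..d i}. \<exists>j\<in>J. P j i a}) / real (d i)
      \<le> (\<Sum>j\<in>J. real (card {a \<in> {1..d i}. P j i a}) / real (d i))"
    by (simp add: always_eventually)
qed auto

text \<open>The mean square splits into a bad set of density at most \<eta>, contributing at most
  \<open>\<eta> * C\<^sup>2\<close>, and the remaining points, contributing at most
  \<open>e\<^sup>2\<close>.\<close>

lemma rho2_le:
  assumes n: "n > 0" and C: "\<And>a. a \<in> {1..n} \<Longrightarrow> mdist \<rho> (\<phi> a) (\<psi> a) \<le> C"
    and good: "\<And>a. a \<in> {1..n} - B \<Longrightarrow> mdist \<rho> (\<phi> a) (\<psi> a) \<le> e"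
    and B: "B \<subseteq> {1..n}" "real (card B) \<le> \<eta> * real n"
    and \<delta>: "\<delta> \<ge> 0" "e\<^sup>2 + \<eta> * C\<^sup>2 \<le> \<delta>\<^sup>2"
  shows "rho2 \<rho> n \<phi> \<psi> \<le> \<delta>"
proof -
  let ?f = "\<lambda>a. (mdist \<rho> (\<phi> a) (\<psi> a))\<^sup>2"
  have "finite B" using B(1) finite_subset by blast
  have "(\<Sum>a\<in>{1..n}. ?f a) = (\<Sum>a\<in>{1..n} - B. ?f a) + (\<Sum>a\<in>B. ?f a)"
    using B(1) by (intro sum.subset_diff) auto
  also have "\<dots> \<le> (\<Sum>a\<in>{1..n} - B. e\<^sup>2) + (\<Sum>a\<in>B. C\<^sup>2)"
    using good C B(1) by (intro add_mono sum_mono power_mono) auto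
  also have "\<dots> \<le> real n * e\<^sup>2 + (\<eta> * real n) * C\<^sup>2"
  proof (intro add_mono)
    have "card ({1..n} - B) \<le> n" using card_mono[of "{1..n}" "{1..n} - B"] by auto
    then show "(\<Sum>a\<in>{1..n} - B. e\<^sup>2) \<le> real n * e\<^sup>2"
      by (simp only: sum_constant) (intro mult_right_mono, auto)
    show "(\<Sum>a\<in>B. C\<^sup>2) \<le> (\<eta> * real n) * C\<^sup>2"
      using B(2) by (simp only: sum_constant) (intro mult_right_mono, auto)
  qed
  also have "\<dots> = real n * (e\<^sup>2 + \<eta> * C\<^sup>2)" by (simp add: algebra_simps)
  also have "\<dots> \<le> real n * \<delta>\<^sup>2" using \<delta> by (intro mult_left_mono) auto
  finally have "(\<Sum>a\<in>{1..n}. ?f a) / real n \<le> \<delta>\<^sup>2" using n by (simp add: field_simps)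
  then show ?thesis unfolding rho2_def using \<delta>(1) by (simp add: real_le_lsqrt)
qed

text \<open>The value at \<open>a\<close> is the image under \<pi> of the configuration that reads
  \<open>z\<close> along the approximate orbit of \<open>a\<close>. Inverting \<open>t\<close> makes
  replacing \<open>a\<close> by \<open>\<sigma> s a\<close> correspond to the left shift by
  \<open>s\<close>, as far as \<sigma> is multiplicative.\<close>

definition sofic_model ::
  "('g, 'm) monoid_scheme \<Rightarrow> nat \<Rightarrow> ('g \<Rightarrow> nat \<Rightarrow> nat) \<Rightarrow> (('g \<Rightarrow> 'z) \<Rightarrow> 'y) \<Rightarrow> (nat \<Rightarrow> 'z) \<Rightarrow> nat \<Rightarrow> 'y"
  where "sofic_model G n \<sigma> \<pi> z = (\<lambda>a\<in>{1..n}. \<pi> (\<lambda>t\<in>carrier G. z (\<sigma> (inv\<^bsub>G\<^esub> t) a)))"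

lemma compact_space_shift_space: "compact_space Z \<Longrightarrow> compact_space (shift_space G Z)"
  by (simp add: shift_space_def compact_space_product_topology)

lemma sofic_window_in_shift_space:
  assumes "group G" "\<And>s. s \<in> carrier G \<Longrightarrow> \<sigma> s permutes {1..n}" "z \<in> {1..n} \<rightarrow> topspace Z" "a \<in> {1..n}"
  shows "(\<lambda>t\<in>carrier G. z (\<sigma> (inv\<^bsub>G\<^esub> t) a)) \<in> topspace (shift_space G Z)"
proof -
  have "\<sigma> (inv\<^bsub>G\<^esub> t) a \<in> {1..n}" if "t \<in> carrier G" for t
    using assms(2)[of "inv\<^bsub>G\<^esub> t"] assms(4) group.inv_closed[OF assms(1) that] permutes_in_image by metis
  then show ?thesis using assms(3) by (auto simp: shift_space_def Pi_iff)
qed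

text \<open>Up to \<open>\<delta> / 2\<close>, \<pi> sees only a finite set of coordinates, and on
  these \<sigma> is multiplicative outside a set of small density. That exceptional set depends on
  \<sigma> alone, so one threshold for \<open>i\<close> serves all labellings \<open>z\<close> at
  once.\<close>

lemma eventually_sofic_model_in_Map_set:
  fixes G (structure)
  assumes G: "group G" and sofic: "sofic_approximation G d \<sigma>" and Z: "compact_space Z"
    and factor: "is_factor G (shift_space G Z) (left_shift G Z) Y \<beta> \<pi>"
    and \<rho>: "mtopology_of \<rho> = Y" and F: "finite F" "F \<subseteq> carrier G" and \<delta>: "\<delta> > 0"
  shows "\<forall>\<^sub>F i in sequentially. \<forall>z\<in>{1..d i} \<rightarrow> topspace Z.
           sofic_model G (d i) (\<sigma> i) \<pi> z \<in> Map_set Y \<beta> \<rho> F \<delta> (d i) (\<sigma> i)"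
proof -
  interpret group G by fact
  let ?X = "shift_space G Z"
  have compX: "compact_space ?X" using Z by (rule compact_space_shift_space)
  have contf: "continuous_map ?X (mtopology_of \<rho>) \<pi>"
    and equiv: "\<And>s x. s \<in> carrier G \<Longrightarrow> x \<in> topspace ?X \<Longrightarrow> \<pi> (left_shift G Z s x) = \<beta> s (\<pi> x)"
    and compY: "compact_space Y"
    using factor \<rho> unfolding is_factor_def by auto
  have \<pi>Y: "\<pi> x \<in> mspace \<rho>" if "x \<in> topspace ?X" for x
    using contf that unfolding continuous_map_def by auto
  have Y: "topspace Y = mspace \<rho>" using \<rho> by auto
  \<comment> \<open>A diameter bound for the compact space \<open>Y\<close> controls the points
    where equivariance fails.\<close>
  obtain C where C: "\<And>x y. x \<in> mspace \<rho> \<Longrightarrow> y \<in> mspace \<rho> \<Longrightarrow> mdist \<rho> x y \<le> C"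
  proof -
    interpret M: Metric_space "mspace \<rho>" "mdist \<rho>" by blast
    have "compactin M.mtopology (mspace \<rho>)"
      using compY \<rho> unfolding compact_space_def mtopology_of_def by auto
    then have "M.mbounded (mspace \<rho>)" by (rule M.compactin_imp_mbounded)
    then show ?thesis using that unfolding M.mbounded_alt by blast
  qed
  obtain K where K: "finite K" "K \<subseteq> carrier G"
    "\<And>x y. \<lbrakk>x \<in> topspace ?X; y \<in> topspace ?X; \<forall>i\<in>K. x i = y i\<rbrakk> \<Longrightarrow> mdist \<rho> (\<pi> x) (\<pi> y) < \<delta> / 2"
    by (rule continuous_map_product_finite_dependence[OF compX[unfolded shift_space_def]
          contf[unfolded shift_space_def] half_gt_zero[OF \<delta>], folded shift_space_def], rule that)
  \<comment> \<open>Off this set, the window read at \<open>\<sigma> i s a\<close> is on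
    \<open>K\<close> exactly the shifted window read at \<open>a\<close>.\<close>
  define bad where "bad s i = {a \<in> {1..d i}. \<exists>t\<in>K. \<sigma> i (inv t) (\<sigma> i s a) \<noteq> \<sigma> i (inv t \<otimes> s) a}" for s i
  \<comment> \<open>Bad points then contribute at most \<open>\<delta>\<^sup>2 / 2\<close> and good
    ones at most \<open>\<delta>\<^sup>2 / 4\<close>. The summand 1 keeps \<eta> positive even when
    \<open>C\<close> is 0.\<close>
  define \<eta> where "\<eta> = \<delta>\<^sup>2 / (2 * (C\<^sup>2 + 1))"
  have C1: "C\<^sup>2 + 1 > 0" by (simp add: add_nonneg_pos)
  have \<eta>: "\<eta> > 0" using \<delta> C1 by (simp add: \<eta>_def)
  have d0: "d i > 0" and perm: "\<And>s. s \<in> carrier G \<Longrightarrow> \<sigma> i s permutes {1..d i}" for i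
    using sofic by (auto simp: sofic_approximation_def)
  have "(\<lambda>i. real (card (bad s i)) / real (d i)) \<longlonglongrightarrow> 0" if s: "s \<in> carrier G" for s
    unfolding bad_def
  proof (rule density_bex_tendsto_0[OF K(1)])
    fix t assume "t \<in> K"
    then have t: "inv t \<in> carrier G" using K(2) by auto
    let ?E = "\<lambda>i. {a \<in> {1..d i}. \<sigma> i (inv t) (\<sigma> i s a) = \<sigma> i (inv t \<otimes> s) a}"
    have "(\<lambda>i. real (card (?E i)) / real (d i)) \<longlonglongrightarrow> 1"
      using sofic s t unfolding sofic_approximation_def by blast
    then have "(\<lambda>i. 1 - real (card (?E i)) / real (d i)) \<longlonglongrightarrow> 1 - 1"
      by (intro tendsto_diff tendsto_const)
    moreover have "real (card {a \<in> {1..d i}. \<sigma> i (inv t) (\<sigma> i s a) \<noteq> \<sigma> i (inv t \<otimes> s) a}) / real (d i)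
        = 1 - real (card (?E i)) / real (d i)" for i
    proof -
      have "{a \<in> {1..d i}. \<sigma> i (inv t) (\<sigma> i s a) \<noteq> \<sigma> i (inv t \<otimes> s) a} = {1..d i} - ?E i" by auto
      moreover have "card (?E i) \<le> card {1..d i}" by (rule card_mono) auto
      moreover have "card ({1..d i} - ?E i) = card {1..d i} - card (?E i)"
        by (rule card_Diff_subset) auto
      ultimately have "real (card {a \<in> {1..d i}. \<sigma> i (inv t) (\<sigma> i s a) \<noteq> \<sigma> i (inv t \<otimes> s) a})
          = real (d i) - real (card (?E i))" by (metis (lifting) card_atLeastAtMost diff_Suc_1 of_nat_diff)
      then show ?thesis using d0[of i] by (simp add: diff_divide_distrib)
    qed
    ultimately show "(\<lambda>i. real (card {a \<in> {1..d i}. \<sigma> i (inv t) (\<sigma> i s a) \<noteq> \<sigma> i (inv t \<otimes> s) a}) / real (d i)) \<longlonglongrightarrow> 0"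
      by simp
  qed
  then have "\<forall>s\<in>F. \<forall>\<^sub>F i in sequentially. real (card (bad s i)) / real (d i) < \<eta>"
    using F(2) by (intro ballI order_tendstoD(2)[OF _ \<eta>]) blast
  then have "\<forall>\<^sub>F i in sequentially. \<forall>s\<in>F. real (card (bad s i)) / real (d i) < \<eta>"
    using F(1) by (simp add: eventually_ball_finite)
  then show ?thesis
  proof eventually_elim
    case (elim i)
    show ?case
    proof
      fix z assume z: "z \<in> {1..d i} \<rightarrow> topspace Z"
      let ?\<phi> = "sofic_model G (d i) (\<sigma> i) \<pi> z"
      define \<xi> where "\<xi> a = (\<lambda>t\<in>carrier G. z (\<sigma> i (inv t) a))" for a
      have \<xi>: "\<xi> a \<in> topspace ?X" if "a \<in> {1..d i}" for a
        unfolding \<xi>_def using sofic_window_in_shift_space[OF G perm z that] .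
      have \<phi>: "?\<phi> a = \<pi> (\<xi> a)" if "a \<in> {1..d i}" for a
        using that by (simp add: sofic_model_def \<xi>_def)
      have "rho2 \<rho> (d i) (?\<phi> \<circ> \<sigma> i s) (\<beta> s \<circ> ?\<phi>) \<le> \<delta>" if s: "s \<in> F" for s
      proof (rule rho2_le[where C=C and e="\<delta>/2" and B="bad s i" and \<eta>=\<eta>])
        have sG: "s \<in> carrier G" using s F by blast
        have \<sigma>a: "\<sigma> i s a \<in> {1..d i}" if "a \<in> {1..d i}" for a
          using perm[OF sG, of i] that permutes_in_image by metis
        have shift: "left_shift G Z s x = (\<lambda>t\<in>carrier G. x (inv s \<otimes> t))" if "x \<in> topspace ?X" for x
          using that by (simp add: left_shift_def)
        have shiftX: "left_shift G Z s x \<in> topspace ?X" if "x \<in> topspace ?X" for x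
          unfolding shift[OF that] using that sG by (auto simp: shift_space_def PiE_iff)
        have eq: "(?\<phi> \<circ> \<sigma> i s) a = \<pi> (\<xi> (\<sigma> i s a))" "(\<beta> s \<circ> ?\<phi>) a = \<pi> (left_shift G Z s (\<xi> a))"
          if "a \<in> {1..d i}" for a
          using that \<sigma>a \<phi> \<xi> equiv[OF sG] by auto
        show "mdist \<rho> ((?\<phi> \<circ> \<sigma> i s) a) ((\<beta> s \<circ> ?\<phi>) a) \<le> C" if "a \<in> {1..d i}" for a
          unfolding eq[OF that] using that by (intro C \<pi>Y shiftX \<xi> \<sigma>a)
        show "mdist \<rho> ((?\<phi> \<circ> \<sigma> i s) a) ((\<beta> s \<circ> ?\<phi>) a) \<le> \<delta> / 2" if a: "a \<in> {1..d i} - bad s i" for a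
        proof -
          have a1: "a \<in> {1..d i}" using a by blast
          have "\<xi> (\<sigma> i s a) t = left_shift G Z s (\<xi> a) t" if t: "t \<in> K" for t
          proof -
            have tG: "t \<in> carrier G" using t K by blast
            have "inv (inv s \<otimes> t) = inv t \<otimes> s" using tG sG by (simp add: inv_mult_group)
            then have "left_shift G Z s (\<xi> a) t = z (\<sigma> i (inv t \<otimes> s) a)"
              using tG sG shift[OF \<xi>[OF a1]] by (simp add: \<xi>_def)
            moreover have "\<sigma> i (inv t) (\<sigma> i s a) = \<sigma> i (inv t \<otimes> s) a"
              using a t by (auto simp: bad_def)
            ultimately show ?thesis using tG by (simp add: \<xi>_def)
          qed
          then show ?thesis unfolding eq[OF a1]
            by (intro less_imp_le K(3) shiftX \<xi> \<sigma>a a1) blast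
        qed
        show "real (card (bad s i)) \<le> \<eta> * real (d i)"
          using elim s d0[of i] by (auto simp: field_simps intro: less_imp_le)
        have "\<eta> * C\<^sup>2 \<le> \<eta> * (C\<^sup>2 + 1)" using \<eta> by simp
        also have "\<dots> = \<delta>\<^sup>2 / 2"
        proof -
          have "\<delta>\<^sup>2 / (2 * q) * q = \<delta>\<^sup>2 / 2" if "q > 0" for q using that by simp
          from this[OF C1] show ?thesis by (simp only: \<eta>_def)
        qed
        finally have "(\<delta>/2)\<^sup>2 + \<eta> * C\<^sup>2 \<le> \<delta>\<^sup>2 / 4 + \<delta>\<^sup>2 / 2" by (simp add: power_divide)
        also have "\<dots> \<le> \<delta>\<^sup>2" by simp
        finally show "(\<delta>/2)\<^sup>2 + \<eta> * C\<^sup>2 \<le> \<delta>\<^sup>2" .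
      qed (use d0 \<delta> in \<open>auto simp: bad_def\<close>)
      moreover have "?\<phi> \<in> {1..d i} \<rightarrow>\<^sub>E topspace Y"
        using \<phi> \<pi>Y \<xi> Y by (auto simp: PiE_iff sofic_model_def extensional_def)
      ultimately show "?\<phi> \<in> Map_set Y \<beta> \<rho> F \<delta> (d i) (\<sigma> i)" by (simp add: Map_set_def)
    qed
  qed
qed

text \<open>Each \<open>a\<close> in \<open>A\<close> owns one cube coordinate, which moves the
  \<open>g\<close>-entry of its window along \<gamma> while the other entries copy \<open>v\<close>.
  On the two opposite faces the window agrees on \<open>K\<close> with \<open>v\<close>,
  respectively \<open>w\<close>, so the model at \<open>a\<close> is within \<open>e\<close> of
  \<open>\<pi> v\<close>, respectively \<open>\<pi> w\<close>. The factor at \<open>a\<close> of a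
  member of the power cover stays away from one of these two points, hence the member misses one
  face.\<close>

lemma Map_dim_ge_of_separated_windows:
  fixes G (structure)
  assumes G: "group G" and perm: "\<And>s. s \<in> carrier G \<Longrightarrow> \<sigma> s permutes {1..n}"
    and \<pi>: "continuous_map (shift_space G Z) Y \<pi>" and \<rho>: "mtopology_of \<rho> = Y"
    and v: "v \<in> topspace (shift_space G Z)" and w: "w \<in> topspace (shift_space G Z)"
    and K: "K \<subseteq> carrier G" "g \<in> K" and vw: "\<forall>t\<in>carrier G - {g}. v t = w t"
    and dep: "\<And>x y. \<lbrakk>x \<in> topspace (shift_space G Z); y \<in> topspace (shift_space G Z); \<forall>t\<in>K. x t = y t\<rbrakk>
        \<Longrightarrow> mdist \<rho> (\<pi> x) (\<pi> y) < e"
    and \<gamma>: "pathin Z \<gamma>" "\<gamma> 0 = v g" "\<gamma> 1 = w g"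
    and \<U>: "finite_open_cover Y \<U>"
      "\<And>U. U \<in> \<U> \<Longrightarrow> (\<forall>y\<in>U. e \<le> mdist \<rho> y (\<pi> v)) \<or> (\<forall>y\<in>U. e \<le> mdist \<rho> y (\<pi> w))"
    and A: "A \<subseteq> {1..n}" "inj_on (\<lambda>(a, t). \<sigma> (inv\<^bsub>G\<^esub> t) a) (A \<times> K)"
    and models: "\<And>z. z \<in> {1..n} \<rightarrow> topspace Z \<Longrightarrow> sofic_model G n \<sigma> \<pi> z \<in> Map_set Y \<beta> \<rho> F \<delta> n \<sigma>"
  shows "int (card A) \<le> Map_dim Y \<beta> \<U> \<rho> F \<delta> n \<sigma>"
proof -
  interpret group G by fact
  let ?X = "shift_space G Z"
  let ?Q = "top_of_set hilbert_cube"
  have gG: "g \<in> carrier G" using K by blast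
  have "finite A" using A(1) finite_subset by blast
  then obtain h where h: "bij_betw h A {..<card A}" using ex_bij_betw_finite_nat atLeast0LessThan by metis
  define win where "win = (\<lambda>(a, t). \<sigma> (inv t) a)"
  have inj: "inj_on win (A \<times> K)" using A(2) by (simp add: win_def)
  define val where "val u = (\<lambda>(a, t). if t = g then \<gamma> (u (h a)) else v t)" for u :: "nat \<Rightarrow> real"
  \<comment> \<open>Injectivity of \<open>win\<close> decodes each window position into a unique
    pair \<open>(a, t)\<close>, so the windows can be filled independently. Positions outside all
    windows get the constant filler \<open>v g\<close>.\<close>
  define z where "z u b = (if b \<in> win ` (A \<times> K) then val u (inv_into (A \<times> K) win b) else v g)" for u b
  have zwin: "z u (\<sigma> (inv t) a) = (if t = g then \<gamma> (u (h a)) else v t)" if "a \<in> A" "t \<in> K" for u a t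
  proof -
    have "win (a, t) \<in> win ` (A \<times> K)" "inv_into (A \<times> K) win (win (a, t)) = (a, t)"
      using inj that by (auto intro!: inv_into_f_f)
    then have "z u (win (a, t)) = val u (a, t)" unfolding z_def by simp
    then show ?thesis by (simp add: win_def val_def)
  qed
  have vZ: "v t \<in> topspace Z" if "t \<in> carrier G" for t
    using v that by (auto simp: shift_space_def)
  \<comment> \<open>For fixed \<open>b\<close> the label is constant in \<open>u\<close> or is
    \<gamma> applied to a single coordinate of \<open>u\<close>.\<close>
  have zc: "continuous_map ?Q Z (\<lambda>u. z u b)" for b
  proof (cases "b \<in> win ` (A \<times> K)")
    case False
    then show ?thesis using vZ[OF gG] by (simp add: z_def)
  next
    case True
    then obtain a t where at: "a \<in> A" "t \<in> K" "b = \<sigma> (inv t) a" by (auto simp: win_def)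
    show ?thesis
    proof (cases "t = g")
      case True
      have "continuous_map ?Q (top_of_set {0..1}) (\<lambda>u. u (h a))"
      proof -
        have "continuous_on hilbert_cube (\<lambda>u::nat \<Rightarrow> real. u (h a))"
          by (rule continuous_on_subset[OF continuous_on_product_coordinates]) simp
        then show ?thesis by (auto simp: hilbert_cube_def)
      qed
      then have "continuous_map ?Q Z (\<gamma> \<circ> (\<lambda>u. u (h a)))"
        using \<gamma>(1) unfolding pathin_def by (rule continuous_map_compose)
      then show ?thesis using at True by (simp add: zwin o_def)
    next
      case False
      then show ?thesis using at vZ[of t] K by (auto simp: zwin)
    qed
  qed
  have zZ: "z u \<in> {1..n} \<rightarrow> topspace Z" if "u \<in> hilbert_cube" for u
    using zc that unfolding continuous_map_def by auto
  define \<xi> where "\<xi> u a = (\<lambda>t\<in>carrier G. z u (\<sigma> (inv t) a))" for u a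
  have \<xi>c: "continuous_map ?Q ?X (\<lambda>u. \<xi> u a)" for a
    unfolding shift_space_def continuous_map_componentwise using zc by (auto simp: \<xi>_def)
  have \<xi>X: "\<xi> u a \<in> topspace ?X" if "u \<in> hilbert_cube" for u a
    using \<xi>c[of a] that unfolding continuous_map_def by auto
  define f where "f u = sofic_model G n \<sigma> \<pi> (z u)" for u
  have f: "f u = (\<lambda>a\<in>{1..n}. \<pi> (\<xi> u a))" for u
    by (simp add: f_def sofic_model_def \<xi>_def)
  have "continuous_map ?Q (product_topology (\<lambda>_. Y) {1..n}) f"
    unfolding continuous_map_componentwise
  proof (intro conjI ballI)
    show "f ` topspace ?Q \<subseteq> extensional {1..n}" by (auto simp: f)
    fix a assume "a \<in> {1..n}"
    then show "continuous_map ?Q Y (\<lambda>u. f u a)"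
      using continuous_map_compose[OF \<xi>c \<pi>, of a] by (simp add: f o_def)
  qed
  moreover have "f u \<in> Map_set Y \<beta> \<rho> F \<delta> n \<sigma>" if "u \<in> hilbert_cube" for u
    unfolding f_def using zZ[OF that] by (rule models)
  ultimately have fc: "continuous_map ?Q (Map_space Y \<beta> \<rho> F \<delta> n \<sigma>) f"
    by (auto simp: Map_space_def continuous_map_in_subtopology)
  show ?thesis
    unfolding Map_dim_def
  proof (rule cover_dim_ge_of_cube[OF finite_open_cover_Map_space[OF \<U>(1)] fc])
    fix i S assume i: "i < card A"
      and "S \<in> restrict_cover (power_cover n \<U>) (Map_set Y \<beta> \<rho> F \<delta> n \<sigma>)"
    then obtain U where U: "U \<in> {1..n} \<rightarrow> \<U>" "S \<subseteq> PiE {1..n} U"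
      by (auto simp: restrict_cover_def power_cover_def)
    obtain a where a: "a \<in> A" "h a = i" using h i unfolding bij_betw_def by (metis imageE lessThan_iff)
    then have an: "a \<in> {1..n}" using A(1) by blast
    have fa: "f u a = \<pi> (\<xi> u a)" for u using an by (simp add: f)
    have 0: "mdist \<rho> (f u a) (\<pi> v) < e" if u: "u \<in> hilbert_cube" "u i = 0" for u
      unfolding fa
    proof (rule dep[OF \<xi>X[OF u(1)] v])
      show "\<forall>t\<in>K. \<xi> u a t = v t" using K a u \<gamma> zwin by (auto simp: \<xi>_def)
    qed
    have 1: "mdist \<rho> (f u a) (\<pi> w) < e" if u: "u \<in> hilbert_cube" "u i = 1" for u
      unfolding fa
    proof (rule dep[OF \<xi>X[OF u(1)] w])
      show "\<forall>t\<in>K. \<xi> u a t = w t" using K a u \<gamma> zwin vw by (auto simp: \<xi>_def)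
    qed
    have S: "f u \<in> S \<Longrightarrow> f u a \<in> U a" for u using U(2) an by (auto simp: PiE_iff)
    have "U a \<in> \<U>" using U(1) an by blast
    from \<U>(2)[OF this]
    show "(\<forall>u\<in>hilbert_cube. u i = 0 \<longrightarrow> f u \<notin> S) \<or> (\<forall>u\<in>hilbert_cube. u i = 1 \<longrightarrow> f u \<notin> S)"
      using 0 1 S by (meson not_le)
  qed
qed

text \<open>Two kinds of collision must be avoided. Coincidences within the window of one point are
  rare by asymptotic freeness, and discarding them costs at most half of the points, whence the
  factor 2; windows of different points are then separated by
  \<open>separated_windows\<close>.\<close>

lemma eventually_separated_windows:
  fixes G (structure)
  assumes G: "group G" and sofic: "sofic_approximation G d \<sigma>"
    and K: "finite K" "K \<subseteq> carrier G" "K \<noteq> {}"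
  shows "\<forall>\<^sub>F i in sequentially. \<exists>A\<subseteq>{1..d i}. inj_on (\<lambda>(a, t). \<sigma> i (inv\<^bsub>G\<^esub> t) a) (A \<times> K) \<and>
           real (d i) \<le> 2 * (real (card K))\<^sup>2 * real (card A)"
proof -
  interpret group G by fact
  have d0: "d i > 0" and perm: "\<And>s. s \<in> carrier G \<Longrightarrow> \<sigma> i s permutes {1..d i}" for i
    using sofic by (auto simp: sofic_approximation_def)
  define bad where
    "bad i = {a \<in> {1..d i}. \<exists>(s, t) \<in> {(s, t) \<in> K \<times> K. s \<noteq> t}. \<sigma> i (inv s) a = \<sigma> i (inv t) a}" for i
  have "(\<lambda>i. real (card (bad i)) / real (d i)) \<longlonglongrightarrow> 0"
    unfolding bad_def
  proof (rule density_bex_tendsto_0)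
    show "finite {(s, t) \<in> K \<times> K. s \<noteq> t}"
      by (rule finite_subset[of _ "K \<times> K"]) (use K in auto)
    fix p assume "p \<in> {(s, t) \<in> K \<times> K. s \<noteq> t}"
    then obtain s t where st: "p = (s, t)" "s \<in> carrier G" "t \<in> carrier G" "s \<noteq> t" using K by auto
    then have "inv s \<noteq> inv t" by (metis inv_inv)
    then have "(\<lambda>i. real (card {a \<in> {1..d i}. \<sigma> i (inv s) a = \<sigma> i (inv t) a}) / real (d i)) \<longlonglongrightarrow> 0"
      using sofic st unfolding sofic_approximation_def by (meson inv_closed)
    then show "(\<lambda>i. real (card {a \<in> {1..d i}. case p of (s, t) \<Rightarrow> \<sigma> i (inv s) a = \<sigma> i (inv t) a}) / real (d i)) \<longlonglongrightarrow> 0"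
      using st by simp
  qed
  then have "\<forall>\<^sub>F i in sequentially. real (card (bad i)) / real (d i) < 1/2"
    by (rule order_tendstoD) simp
  then show ?thesis
  proof eventually_elim
    case (elim i)
    define B where "B = {1..d i} - bad i"
    have Binj: "s = t" if "a \<in> B" "s \<in> K" "t \<in> K" "\<sigma> i (inv s) a = \<sigma> i (inv t) a" for a s t
      using that by (auto simp: B_def bad_def)
    have injB: "inj_on (\<sigma> i (inv t)) B" if "t \<in> K" for t
      using perm[of "inv t" i] K that permutes_inj[of "\<sigma> i (inv t)"] by (auto intro: inj_on_subset)
    obtain A where A: "A \<subseteq> B" "card B \<le> (card K)\<^sup>2 * card A"
      "\<And>a b s t. \<lbrakk>a \<in> A; b \<in> A; s \<in> K; t \<in> K; \<sigma> i (inv s) a = \<sigma> i (inv t) b\<rbrakk> \<Longrightarrow> a = b"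
    proof (rule separated_windows[of B K "\<lambda>t. \<sigma> i (inv t)"])
      show "finite B" by (simp add: B_def)
      show "inj_on (\<sigma> i (inv t)) B" if "t \<in> K" for t using injB[OF that] .
    qed (use K that in auto)
    have "inj_on (\<lambda>(a, t). \<sigma> i (inv t) a) (A \<times> K)"
    proof (rule inj_onI, clarify)
      fix a s b t assume *: "a \<in> A" "s \<in> K" "b \<in> A" "t \<in> K" "\<sigma> i (inv s) a = \<sigma> i (inv t) b"
      then have "a = b" using A(3) by blast
      then show "a = b \<and> s = t" using Binj[of a s t] * A(1) by auto
    qed
    moreover have "real (d i) \<le> 2 * (real (card K))\<^sup>2 * real (card A)"
    proof -
      have bs: "bad i \<subseteq> {1..d i}" by (auto simp: bad_def)
      then have fb: "finite (bad i)" using finite_subset by blast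
      have "card B = d i - card (bad i)" unfolding B_def using bs fb by (simp add: card_Diff_subset)
      then have "real (card B) \<ge> real (d i) - real (card (bad i))" by linarith
      moreover have "real (card (bad i)) < real (d i) / 2" using elim d0[of i] by (simp add: field_simps)
      moreover have "real (card B) \<le> (real (card K))\<^sup>2 * real (card A)"
        using A(2) by (metis of_nat_le_iff of_nat_mult of_nat_power)
      ultimately show ?thesis by linarith
    qed
    moreover have "A \<subseteq> {1..d i}" using A(1) by (auto simp: B_def)
    ultimately show ?case by blast
  qed
qed

section \<open>The separating cover and a density bound uniform in the approximation
  parameters\<close>

theorem theorem7p5:
  fixes G :: "('g, 'm) monoid_scheme"
    and d :: "nat \<Rightarrow> nat" and \<sigma> :: "nat \<Rightarrow> 'g \<Rightarrow> nat \<Rightarrow> nat"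
    and Z :: "'z topology"
    and Y :: "'y topology" and \<beta> :: "'g \<Rightarrow> 'y \<Rightarrow> 'y" and \<pi> :: "('g \<Rightarrow> 'z) \<Rightarrow> 'y"
    and \<rho> :: "'y metric"
  assumes "group G" and "countable (carrier G)"
    and "sofic_approximation G d \<sigma>"
    and "compact_space Z" and "metrizable_space Z" and "path_connected_space Z"
    and "is_factor G (shift_space G Z) (left_shift G Z) Y \<beta> \<pi>"
    and "nontrivial_space Y"
    and "mtopology_of \<rho> = Y"
  shows "sofic_mdim G d \<sigma> Y \<beta> \<rho> > 0"
proof -
  note G = assms(1) and sofic = assms(3) and factor = assms(7) and \<rho> = assms(9)
  let ?X = "shift_space G Z"
  interpret M: Metric_space "mspace \<rho>" "mdist \<rho>" by blast
  have mtop: "M.mtopology = Y" using \<rho> by (simp add: mtopology_of_def)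
  have topY: "topspace Y = mspace \<rho>" using \<rho> by auto
  have compX: "compact_space ?X" using assms(4) by (rule compact_space_shift_space)
  have contY: "continuous_map ?X Y \<pi>" and surj: "\<pi> ` topspace ?X = topspace Y"
    using factor by (auto simp: is_factor_def)
  have cont: "continuous_map ?X (mtopology_of \<rho>) \<pi>" using contY \<rho> by simp
  have d0: "d i > 0" and perm: "\<And>s. s \<in> carrier G \<Longrightarrow> \<sigma> i s permutes {1..d i}" for i
    using sofic by (auto simp: sofic_approximation_def)
  obtain p q where "p \<in> \<pi> ` topspace ?X" "q \<in> \<pi> ` topspace ?X" "p \<noteq> q"
    using assms(8) surj unfolding nontrivial_space_def by blast
  then obtain x y where xy: "x \<in> topspace ?X" "y \<in> topspace ?X" "\<pi> x \<noteq> \<pi> y"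
    by blast
  obtain g v w where g: "g \<in> carrier G" and v: "v \<in> topspace ?X" and w: "w \<in> topspace ?X"
    and vw: "\<forall>t\<in>carrier G - {g}. v t = w t" and ne: "\<pi> v \<noteq> \<pi> w"
    by (rule continuous_map_product_single_coordinate[OF compX[unfolded shift_space_def]
          cont[unfolded shift_space_def] xy[unfolded shift_space_def], folded shift_space_def], rule that)
  have \<pi>vw: "\<pi> v \<in> mspace \<rho>" "\<pi> w \<in> mspace \<rho>" using surj v w topY by auto
  \<comment> \<open>With a quarter of the distance, the closed balls of radius \<open>e\<close>
    around \<open>\<pi> v\<close> and \<open>\<pi> w\<close> are disjoint, so their complements
    cover \<open>Y\<close>.\<close>
  define e where "e = mdist \<rho> (\<pi> v) (\<pi> w) / 4"
  have e: "e > 0" using ne \<pi>vw by (simp add: e_def)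
  obtain K0 where K0: "finite K0" "K0 \<subseteq> carrier G"
    "\<And>x y. \<lbrakk>x \<in> topspace ?X; y \<in> topspace ?X; \<forall>t\<in>K0. x t = y t\<rbrakk> \<Longrightarrow> mdist \<rho> (\<pi> x) (\<pi> y) < e"
    by (rule continuous_map_product_finite_dependence[OF compX[unfolded shift_space_def]
          cont[unfolded shift_space_def] e, folded shift_space_def], rule that)
  \<comment> \<open>Windows must contain the coordinate \<open>g\<close> that is moved; enlarging
    \<open>K0\<close> preserves the finite dependence.\<close>
  define K where "K = insert g K0"
  have K: "finite K" "K \<subseteq> carrier G" "K \<noteq> {}" "g \<in> K" using K0 g by (auto simp: K_def)
  have dep: "mdist \<rho> (\<pi> x) (\<pi> y) < e" if "x \<in> topspace ?X" "y \<in> topspace ?X" "\<forall>t\<in>K. x t = y t" for x y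
    using that by (intro K0(3)) (auto simp: K_def)
  have "v g \<in> topspace Z" "w g \<in> topspace Z" using v w g by (auto simp: shift_space_def)
  then obtain \<gamma> where \<gamma>: "pathin Z \<gamma>" "\<gamma> 0 = v g" "\<gamma> 1 = w g"
    using assms(6) unfolding path_connected_space_def by meson
  define \<U> where "\<U> = {mspace \<rho> - M.mcball (\<pi> v) e, mspace \<rho> - M.mcball (\<pi> w) e}"
  have "M.mcball (\<pi> v) e \<inter> M.mcball (\<pi> w) e = {}"
  proof -
    have False if "p \<in> M.mcball (\<pi> v) e" "p \<in> M.mcball (\<pi> w) e" for p
    proof -
      have "mdist \<rho> (\<pi> v) (\<pi> w) \<le> e + e"
        using that M.triangle[of "\<pi> v" p "\<pi> w"] by (auto simp: M.commute)
      then show False using e by (simp add: e_def)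
    qed
    then show ?thesis by blast
  qed
  moreover have "openin Y (mspace \<rho> - M.mcball p e)" for p
    using openin_diff[OF openin_topspace M.closedin_mcball] mtop topY by metis
  ultimately have \<U>: "finite_open_cover Y \<U>"
    unfolding finite_open_cover_def \<U>_def topY by auto
  have \<U>2: "(\<forall>y\<in>U. e \<le> mdist \<rho> y (\<pi> v)) \<or> (\<forall>y\<in>U. e \<le> mdist \<rho> y (\<pi> w))" if "U \<in> \<U>" for U
    using that \<pi>vw unfolding \<U>_def by (auto simp: M.commute)
  \<comment> \<open>This is the guaranteed density of \<open>A\<close> in \<open>{1..d i}\<close>.
    It depends only on \<open>K\<close>, not on \<open>F\<close> or \<delta>, and so survives both
    infima.\<close>
  define c where "c = 1 / (2 * (real (card K))\<^sup>2)"
  have cK: "real (card K) > 0" using K by (simp add: card_gt_0_iff)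
  then have c: "c > 0" by (simp add: c_def)
  have "ereal c \<le> mdim_cover_at d \<sigma> Y \<beta> \<U> \<rho> F \<delta>"
    if F: "finite F" "F \<subseteq> carrier G" and \<delta>: "\<delta> > 0" for F \<delta>
  proof -
    note models = eventually_sofic_model_in_Map_set[OF G sofic assms(4) factor \<rho> F \<delta>]
    \<comment> \<open>The model of a constant labelling rules out the branch of
      \<open>mdim_cover_at\<close> with value minus infinity.\<close>
    have "\<forall>\<^sub>F i in sequentially. Map_set Y \<beta> \<rho> F \<delta> (d i) (\<sigma> i) \<noteq> {}"
      using models
    proof eventually_elim
      case (elim i)
      have "(\<lambda>_. v g) \<in> {1..d i} \<rightarrow> topspace Z" using \<open>v g \<in> topspace Z\<close> by simp
      then show ?case using elim by blast
    qed
    then have "\<not> (\<forall>\<^sub>F i in sequentially. Map_set Y \<beta> \<rho> F \<delta> (d i) (\<sigma> i) = {})"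
      using eventually_conj eventually_happens'[OF sequentially_bot] by blast
    moreover have "\<forall>\<^sub>F i in sequentially.
        ereal c \<le> ereal (real_of_int (Map_dim Y \<beta> \<U> \<rho> F \<delta> (d i) (\<sigma> i)) / real (d i))"
      using models eventually_separated_windows[OF G sofic K(1-3)]
    proof eventually_elim
      case (elim i)
      then obtain A where A: "A \<subseteq> {1..d i}" "inj_on (\<lambda>(a, t). \<sigma> i (inv\<^bsub>G\<^esub> t) a) (A \<times> K)"
        "real (d i) \<le> 2 * (real (card K))\<^sup>2 * real (card A)" by blast
      have "int (card A) \<le> Map_dim Y \<beta> \<U> \<rho> F \<delta> (d i) (\<sigma> i)"
        using elim(1)
        by (intro Map_dim_ge_of_separated_windows[OF G perm contY \<rho> v w K(2,4) vw dep \<gamma> \<U> \<U>2 A(1,2)]) auto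
      then have "real (card A) \<le> real_of_int (Map_dim Y \<beta> \<U> \<rho> F \<delta> (d i) (\<sigma> i))" by linarith
      moreover have "c * real (d i) \<le> real (card A)"
        using A(3) cK by (simp add: c_def field_simps)
      ultimately show ?case using d0[of i] by (simp add: field_simps)
    qed
    ultimately show ?thesis
      unfolding mdim_cover_at_def by (auto intro!: le_Limsup)
  qed
  then have "ereal c \<le> mdim_cover G d \<sigma> Y \<beta> \<rho> \<U>"
    unfolding mdim_cover_def by (intro INF_greatest) auto
  also have "\<dots> \<le> sofic_mdim G d \<sigma> Y \<beta> \<rho>"
    unfolding sofic_mdim_def using \<U> by (intro SUP_upper) auto
  finally show ?thesis using c by (metis ereal_less(2) less_le_trans)
qed

end
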